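(* Let $\vartheta \in \mathbb{R}$, $\tau > 0$, and let $X \sim N(\vartheta, \tau^2)$ be a real Gaussian random variable with mean $\vartheta$ and variance $\tau^2$. For integers $k \geq 1$ let $$a_k = \frac{1}{k}\left[ e^{k\vartheta + \frac{k^2\tau^2}{2}}\, \Phi\left(-\frac{\vartheta}{\tau} - k\tau\right) + e^{-k\vartheta + \frac{k^2\tau^2}{2}}\, \Phi\left(\frac{\vartheta}{\tau} - k\tau\right) \right],$$ and for integers $K \geq 1$ let $$S_K = \frac{\tau}{\sqrt{2\pi}} e^{-\frac{\vartheta^2}{2\tau^2}} + \vartheta\, \Phi\left(\frac{\vartheta}{\tau}\right) + \sum_{k=1}^{K} (-1)^{k-1} a_k.$$ Then $$\lim_{K \to \infty} S_{2K} = \mathbb{E}\left[\log(1 + \exp(X))\right].$$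
   Context: $\Phi$ denotes the cumulative distribution function of the standard normal distribution $N(0,1)$, and $\log$ is the natural logarithm. *)

theory Defs
  imports "HOL-Probability.Probability"
begin

abbreviation Phi :: "real \<Rightarrow> real" where
  "Phi \<equiv> cdf std_normal_distribution"

(* The closed form of E[exp (- k * |X|)] / k for X normal with mean \<theta> and variance \<tau>^2, k >= 1. *)
definition softplus_coeff :: "real \<Rightarrow> real \<Rightarrow> nat \<Rightarrow> real" where
  "softplus_coeff \<theta> \<tau> k =
     1 / real k *
       (exp (real k * \<theta> + (real k)\<^sup>2 * \<tau>\<^sup>2 / 2) * Phi (- \<theta> / \<tau> - real k * \<tau>) +
        exp (- real k * \<theta> + (real k)\<^sup>2 * \<tau>\<^sup>2 / 2) * Phi (\<theta> / \<tau> - real k * \<tau>))"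

(* The first two summands are the closed form of E[max X 0]; the alternating sum comes from
   ln (1 + exp x) = max x 0 + ln (1 + exp (- |x|)). *)
definition softplus_partial :: "real \<Rightarrow> real \<Rightarrow> nat \<Rightarrow> real" where
  "softplus_partial \<theta> \<tau> K =
     \<tau> / sqrt (2 * pi) * exp (- \<theta>\<^sup>2 / (2 * \<tau>\<^sup>2)) + \<theta> * Phi (\<theta> / \<tau>) +
     (\<Sum>k = 1..K. (- 1) ^ (k - 1) * softplus_coeff \<theta> \<tau> k)"

end

theory Submission
  imports Defs
begin

text \<open>
  Split \<open>ln (1 + exp x) = max x 0 + ln (1 + exp (- \<bar>x\<bar>))\<close> and expand the second summand as the
  alternating series in \<open>exp (- \<bar>x\<bar>) \<in> (0, 1)\<close>, for \<open>x \<noteq> 0\<close>. Its even partial sums lie between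
  \<open>0\<close> and \<open>ln 2\<close>, so dominated convergence applies to them. Each term is integrated in closed form
  because multiplying a normal density by \<open>exp (c * x)\<close> only shifts its mean.
\<close>

section \<open>Gaussian integrals: tails, exponential tilting and the positive part\<close>

lemma integrable_normal_density_indicator:
  assumes "\<sigma> > 0" "A \<in> sets lborel"
  shows "integrable lborel (\<lambda>x. normal_density m \<sigma> x * indicator A x)"
  using assms by (intro integrable_real_mult_indicator) auto

lemma Phi_eq_integral:
  "Phi a = (\<integral>x. std_normal_density x * indicator {..a} x \<partial>lborel)"
proof -
  interpret real_distribution std_normal_distribution
    by (rule real_dist_normal_dist)
  have "Phi a = (\<integral>x. indicator {..a} x \<partial>std_normal_distribution)"
    by (simp add: cdf_def)
  also have "\<dots> = (\<integral>x. std_normal_density x * indicator {..a} x \<partial>lborel)"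
    by (subst integral_density) auto
  finally show ?thesis .
qed

text \<open>The absolute value admits negative \<open>c\<close>, so that the same identity serves
  the reflecting substitution used for the upper tail.\<close>

lemma normal_density_affine_std:
  assumes "c \<noteq> 0"
  shows "\<bar>c\<bar> * normal_density m \<bar>c\<bar> (m + c * x) = std_normal_density x"
  using assms by (simp add: normal_density_def real_sqrt_mult power_mult_distrib)

lemma has_bochner_integral_normal_lower_tail:
  assumes "\<sigma> > 0"
  shows "has_bochner_integral lborel (\<lambda>x. normal_density m \<sigma> x * indicator {..a} x) (Phi ((a - m) / \<sigma>))"
proof -
  have "(\<integral>x. normal_density m \<sigma> x * indicator {..a} x \<partial>lborel) =
      \<sigma> * (\<integral>x. normal_density m \<sigma> (m + \<sigma> * x) * indicator {..a} (m + \<sigma> * x) \<partial>lborel)"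
    using assms by (subst lborel_integral_real_affine[of \<sigma> _ m]) auto
  also have "\<dots> = (\<integral>x. \<sigma> * (normal_density m \<sigma> (m + \<sigma> * x) * indicator {..a} (m + \<sigma> * x)) \<partial>lborel)"
    by simp
  also have "\<dots> = Phi ((a - m) / \<sigma>)"
    unfolding Phi_eq_integral
  proof (intro Bochner_Integration.integral_cong refl)
    fix x
    have "m + \<sigma> * x \<le> a \<longleftrightarrow> x \<le> (a - m) / \<sigma>"
      using assms by (auto simp: field_simps)
    then show "\<sigma> * (normal_density m \<sigma> (m + \<sigma> * x) * indicator {..a} (m + \<sigma> * x)) =
        std_normal_density x * indicator {..(a - m) / \<sigma>} x"
      using normal_density_affine_std[of \<sigma> m x] assms by (auto simp: indicator_def)
  qed
  finally show ?thesis
    using assms by (simp add: has_bochner_integral_iff integrable_normal_density_indicator)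
qed

text \<open>The substitution \<open>m - \<sigma> * x\<close> reflects the upper tail onto a lower
  tail of the standard normal density, so the value is a single \<open>Phi\<close> with negated
  argument. The half-line is open so that it later complements \<open>{..0}\<close>.\<close>

lemma has_bochner_integral_normal_upper_tail:
  assumes "\<sigma> > 0"
  shows "has_bochner_integral lborel (\<lambda>x. normal_density m \<sigma> x * indicator {a<..} x) (Phi ((m - a) / \<sigma>))"
proof -
  \<comment> \<open>The reflection sends closed half-lines to closed ones, as in
    \<open>Phi_eq_integral\<close>; the endpoint is a null set.\<close>
  have "(\<integral>x. normal_density m \<sigma> x * indicator {a<..} x \<partial>lborel) =
      (\<integral>x. normal_density m \<sigma> x * indicator {a..} x \<partial>lborel)"
    using AE_lborel_singleton[of a]
    by (intro integral_cong_AE) (auto elim!: eventually_mono simp: indicator_def)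
  also have "\<dots> = \<sigma> * (\<integral>x. normal_density m \<sigma> (m + (- \<sigma>) * x) * indicator {a..} (m + (- \<sigma>) * x) \<partial>lborel)"
    using assms by (subst lborel_integral_real_affine[of "- \<sigma>" _ m]) auto
  also have "\<dots> = (\<integral>x. \<sigma> * (normal_density m \<sigma> (m + (- \<sigma>) * x) * indicator {a..} (m + (- \<sigma>) * x)) \<partial>lborel)"
    by simp
  also have "\<dots> = Phi ((m - a) / \<sigma>)"
    unfolding Phi_eq_integral
  proof (intro Bochner_Integration.integral_cong refl)
    fix x
    have "a \<le> m + (- \<sigma>) * x \<longleftrightarrow> x \<le> (m - a) / \<sigma>"
      using assms by (auto simp: field_simps)
    then show "\<sigma> * (normal_density m \<sigma> (m + (- \<sigma>) * x) * indicator {a..} (m + (- \<sigma>) * x)) =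
        std_normal_density x * indicator {..(m - a) / \<sigma>} x"
      using normal_density_affine_std[of "- \<sigma>" m x] assms by (auto simp: indicator_def)
  qed
  finally show ?thesis
    using assms by (simp add: has_bochner_integral_iff integrable_normal_density_indicator)
qed

text \<open>Complete the square in the exponent: the cross term shifts the mean by
  \<open>c * \<sigma>\<^sup>2\<close>, and the leftover constant is the normal moment generating
  function at \<open>c\<close>.\<close>

lemma exp_mult_normal_density:
  assumes "\<sigma> > 0"
  shows "normal_density m \<sigma> x * exp (c * x) =
    exp (c * m + c\<^sup>2 * \<sigma>\<^sup>2 / 2) * normal_density (m + c * \<sigma>\<^sup>2) \<sigma> x"
proof -
  have "- (x - m)\<^sup>2 / (2 * \<sigma>\<^sup>2) + c * x =
      (c * m + c\<^sup>2 * \<sigma>\<^sup>2 / 2) + - (x - (m + c * \<sigma>\<^sup>2))\<^sup>2 / (2 * \<sigma>\<^sup>2)"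
    using assms by (simp add: divide_simps) (simp add: power2_eq_square algebra_simps)
  then have "exp (- (x - m)\<^sup>2 / (2 * \<sigma>\<^sup>2)) * exp (c * x) =
      exp (c * m + c\<^sup>2 * \<sigma>\<^sup>2 / 2) * exp (- (x - (m + c * \<sigma>\<^sup>2))\<^sup>2 / (2 * \<sigma>\<^sup>2))"
    by (simp add: exp_add [symmetric])
  then show ?thesis
    by (simp add: normal_density_def)
qed

text \<open>Splitting at \<open>0\<close> removes the absolute value: the integrand is tilted with
  \<open>c = k\<close> on \<open>{..0}\<close> and with \<open>c = - k\<close> on
  \<open>{0<..}\<close>, and each piece is a tail of a shifted normal density. The factor
  \<open>real k\<close> cancels the \<open>1 / real k\<close> in
  \<open>softplus_coeff\<close>.\<close>

lemma has_bochner_integral_normal_exp_neg_abs: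
  assumes "\<tau> > 0" "k > 0"
  shows "has_bochner_integral lborel (\<lambda>x. normal_density \<theta> \<tau> x * exp (- real k * \<bar>x\<bar>))
    (real k * softplus_coeff \<theta> \<tau> k)"
proof -
  let ?C = "exp (real k * \<theta> + (real k)\<^sup>2 * \<tau>\<^sup>2 / 2)"
  let ?D = "exp (- real k * \<theta> + (real k)\<^sup>2 * \<tau>\<^sup>2 / 2)"
  have "has_bochner_integral lborel
    (\<lambda>x. ?C * (normal_density (\<theta> + real k * \<tau>\<^sup>2) \<tau> x * indicator {..0} x) +
         ?D * (normal_density (\<theta> + (- real k) * \<tau>\<^sup>2) \<tau> x * indicator {0<..} x))
    (?C * Phi ((0 - (\<theta> + real k * \<tau>\<^sup>2)) / \<tau>) + ?D * Phi ((\<theta> + (- real k) * \<tau>\<^sup>2 - 0) / \<tau>))"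
    using assms
    by (intro has_bochner_integral_add has_bochner_integral_mult_right
        has_bochner_integral_normal_lower_tail has_bochner_integral_normal_upper_tail)
  moreover have "?C * (normal_density (\<theta> + real k * \<tau>\<^sup>2) \<tau> x * indicator {..0} x) +
      ?D * (normal_density (\<theta> + (- real k) * \<tau>\<^sup>2) \<tau> x * indicator {0<..} x) =
      normal_density \<theta> \<tau> x * exp (- real k * \<bar>x\<bar>)" for x
    using exp_mult_normal_density[OF assms(1), of \<theta> x "real k"]
      exp_mult_normal_density[OF assms(1), of \<theta> x "- real k"]
    by (auto simp: indicator_def)
  moreover have "(0 - (\<theta> + real k * \<tau>\<^sup>2)) / \<tau> = - \<theta> / \<tau> - real k * \<tau>"
    and "(\<theta> + (- real k) * \<tau>\<^sup>2 - 0) / \<tau> = \<theta> / \<tau> - real k * \<tau>"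
    using assms by (simp_all add: field_simps power2_eq_square)
  ultimately show ?thesis
    using assms by (simp add: softplus_coeff_def)
qed

text \<open>This gives the boundary value at infinity when \<open>- \<tau>\<^sup>2\<close> times the
  density is used as an antiderivative.\<close>

lemma normal_density_tendsto_0_at_top:
  assumes "\<sigma> > 0"
  shows "(normal_density m \<sigma> \<longlongrightarrow> 0) at_top"
proof -
  have "filterlim (\<lambda>x. (x - m)\<^sup>2 / (2 * \<sigma>\<^sup>2)) at_top at_top"
    using assms by real_asymp
  then have "((\<lambda>x. exp (- ((x - m)\<^sup>2 / (2 * \<sigma>\<^sup>2)))) \<longlongrightarrow> 0) at_top"
    by (intro filterlim_compose[OF exp_at_bot] filterlim_compose[OF filterlim_uminus_at_bot_at_top])
  from tendsto_mult_right[OF this, of "1 / sqrt (2 * pi * \<sigma>\<^sup>2)"] show ?thesis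
    by (simp add: normal_density_def[abs_def])
qed

text \<open>On the positive half-line write \<open>x\<close> as
  \<open>(x - \<theta>) + \<theta>\<close>. The centred part has an explicit antiderivative, because
  the density satisfies a first-order linear differential equation; the constant part is an upper
  tail.\<close>

lemma has_bochner_integral_normal_max_0:
  assumes "\<tau> > 0"
  shows "has_bochner_integral lborel (\<lambda>x. normal_density \<theta> \<tau> x * max x 0)
    (\<tau> / sqrt (2 * pi) * exp (- \<theta>\<^sup>2 / (2 * \<tau>\<^sup>2)) + \<theta> * Phi (\<theta> / \<tau>))"
proof -
  let ?f = "normal_density \<theta> \<tau>"
  let ?F = "\<lambda>x. - \<tau>\<^sup>2 * ?f x"
  have int: "set_integrable lborel {0<..} (\<lambda>x. ?f x * (x - \<theta>))"
    using integrable_normal_moment[OF assms, of \<theta> 1] unfolding set_integrable_def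
    by (intro integrable_mult_indicator) auto
  have der: "(?F has_real_derivative ?f x * (x - \<theta>)) (at x)" for x
  proof -
    have "((\<lambda>x. - (x - \<theta>)\<^sup>2 / (2 * \<tau>\<^sup>2)) has_real_derivative - ((x - \<theta>) / \<tau>\<^sup>2)) (at x)"
      using assms by (auto intro!: derivative_eq_intros simp: field_simps)
    from DERIV_cmult[OF DERIV_cmult[OF DERIV_fun_exp[OF this], of "1 / sqrt (2 * pi * \<tau>\<^sup>2)"], of "- \<tau>\<^sup>2"]
    show ?thesis
      unfolding normal_density_def by (rule DERIV_cong) (use assms in simp)
  qed
  \<comment> \<open>Only the endpoint \<open>0\<close> contributes, and \<open>- ?F 0\<close> is the
    exponential summand of the closed form.\<close>
  have "(LBINT x=ereal 0..\<infinity>. ?f x * (x - \<theta>)) = 0 - ?F 0"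
  proof (rule interval_integral_FTC_integrable[where F = ?F])
    show "set_integrable lborel (einterval (ereal 0) \<infinity>) (\<lambda>x. ?f x * (x - \<theta>))"
      using int by simp
    show "(?F has_vector_derivative ?f x * (x - \<theta>)) (at x)" for x
      using der by (simp add: has_real_derivative_iff_has_vector_derivative)
    show "isCont (\<lambda>x. ?f x * (x - \<theta>)) x" for x
      using assms unfolding normal_density_def by (intro continuous_intros) auto
    have "isCont ?F 0"
      using der by (rule DERIV_isCont)
    then show "((?F \<circ> real_of_ereal) \<longlongrightarrow> ?F 0) (at_right (ereal 0))"
      unfolding ereal_tendsto_simps by (simp add: isCont_def filterlim_at_split)
    show "((?F \<circ> real_of_ereal) \<longlongrightarrow> 0) (at_left \<infinity>)"
      unfolding ereal_tendsto_simps
      using tendsto_mult_left[OF normal_density_tendsto_0_at_top[OF assms, of \<theta>], of "- \<tau>\<^sup>2"]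
      by simp
  qed simp
  then have "has_bochner_integral lborel (\<lambda>x. indicator {0<..} x *\<^sub>R (?f x * (x - \<theta>))) (\<tau>\<^sup>2 * ?f 0)"
    using int unfolding interval_integral_to_infinity_eq set_lebesgue_integral_def set_integrable_def
    by (simp add: has_bochner_integral_iff)
  from has_bochner_integral_add[OF this
      has_bochner_integral_mult_right[OF has_bochner_integral_normal_upper_tail[OF assms, of \<theta> 0], of \<theta>]]
  have "has_bochner_integral lborel
      (\<lambda>x. indicator {0<..} x *\<^sub>R (?f x * (x - \<theta>)) + \<theta> * (?f x * indicator {0<..} x))
      (\<tau>\<^sup>2 * ?f 0 + \<theta> * Phi ((\<theta> - 0) / \<tau>))" .
  moreover have "indicator {0<..} x *\<^sub>R (?f x * (x - \<theta>)) + \<theta> * (?f x * indicator {0<..} x) =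
      ?f x * max x 0" for x
    by (auto simp: indicator_def algebra_simps)
  moreover have "\<tau>\<^sup>2 * ?f 0 = \<tau> / sqrt (2 * pi) * exp (- \<theta>\<^sup>2 / (2 * \<tau>\<^sup>2))"
    using assms by (simp add: normal_density_def real_sqrt_mult power2_eq_square)
  ultimately show ?thesis
    by simp
qed

section \<open>Even partial sums of the logarithm series\<close>

lemma ln_one_plus_alternating:
  fixes u :: real
  assumes "0 < u" "u < 1"
  defines "s \<equiv> \<lambda>n. \<Sum>k = 1..2 * n. (- 1) ^ (k - 1) * (u ^ k / real k)"
  shows "s \<longlonglongrightarrow> ln (1 + u)" and "0 \<le> s n" and "s n \<le> ln 2"
proof -
  \<comment> \<open>The index is shifted to start at \<open>0\<close>, as the Leibniz criterion
    expects; the sign exponent \<open>k - 1\<close> becomes \<open>i\<close>.\<close>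
  define a where "a n = u ^ Suc n / real (Suc n)" for n
  have s_eq: "s n = (\<Sum>i<2 * n. (- 1) ^ i * a i)" for n
    unfolding s_def a_def
    by (rule sum.reindex_bij_witness[of _ Suc "\<lambda>k. k - 1"]) auto
  have pos: "0 \<le> a n" for n
    using assms by (simp add: a_def)
  have mono: "a (Suc n) \<le> a n" for n
    unfolding a_def using assms by (intro frac_le power_decreasing) auto
  have "(\<lambda>n. u ^ Suc n) \<longlonglongrightarrow> 0"
    using LIMSEQ_Suc[OF LIMSEQ_power_zero[of u]] assms by simp
  from tendsto_mult[OF this LIMSEQ_inverse_real_of_nat] have lim: "a \<longlonglongrightarrow> 0"
    by (simp add: a_def[abs_def] divide_inverse)
  \<comment> \<open>Besides convergence, the criterion says that the even partial sums stay below
    the limit, which gives the upper bound. Since \<open>u < 1\<close>, that bound can be taken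
    independent of \<open>u\<close>.\<close>
  note leibniz = summable_Leibniz'[of a, OF lim pos mono]
  have "ln (1 + u) = (\<Sum>n. (- 1) ^ n * (1 / real (n + 1)) * (1 + u - 1) ^ Suc n)"
    using assms by (intro ln_series) auto
  then have suminf: "ln (1 + u) = (\<Sum>i. (- 1) ^ i * a i)"
    by (simp add: a_def)
  show "s \<longlonglongrightarrow> ln (1 + u)"
    using leibniz(3) unfolding suminf s_eq[abs_def] .
  show "s n \<le> ln 2"
  proof -
    have "s n \<le> ln (1 + u)"
      using leibniz(2)[of n] unfolding suminf s_eq .
    also have "\<dots> \<le> ln 2"
      using assms by simp
    finally show ?thesis .
  qed
  \<comment> \<open>Each step adds the pair \<open>a (2 * n) - a (2 * n + 1)\<close>, which is
    nonnegative by \<open>mono\<close>.\<close>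
  show "0 \<le> s n"
  proof (induction n)
    case (Suc n)
    then show ?case
      using mono[of "2 * n"] by (simp add: s_eq)
  qed (simp add: s_eq)
qed

text \<open>For positive \<open>x\<close> factor out \<open>exp x\<close>. The remaining logarithm
  has \<open>exp (- \<bar>x\<bar>)\<close>, which never exceeds \<open>1\<close>, in place of the
  unbounded \<open>exp x\<close>, and so can be expanded in powers.\<close>

lemma ln_one_plus_exp_eq:
  fixes x :: real
  shows "ln (1 + exp x) = max x 0 + ln (1 + exp (- \<bar>x\<bar>))"
proof (cases "x \<le> 0")
  case False
  have "1 + exp x = exp x * (1 + exp (- x))"
    by (simp add: algebra_simps exp_minus)
  also have "ln \<dots> = x + ln (1 + exp (- x))"
    using add_pos_pos[OF zero_less_one exp_gt_zero[of "- x"]] by (simp add: ln_mult_pos)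
  finally show ?thesis
    using False by simp
qed simp

section \<open>Transfer to the random variable and passage to the limit\<close>

lemma has_bochner_integral_distributed:
  assumes "distributed M N X f" "g \<in> borel_measurable N" "\<And>x. x \<in> space N \<Longrightarrow> 0 \<le> f x"
    and "has_bochner_integral N (\<lambda>x. f x * g x) (c :: real)"
  shows "has_bochner_integral M (\<lambda>\<omega>. g (X \<omega>)) c"
  using assms distributed_integrable[of M N X f g] distributed_integral[of M N X f g]
  by (simp add: has_bochner_integral_iff)

theorem corollary2p3:
  fixes M :: "'a measure" and X :: "'a \<Rightarrow> real" and \<theta> \<tau> :: real
  assumes "prob_space M"
    and "\<tau> > 0"
    and "distributed M lborel X (normal_density \<theta> \<tau>)"
  shows "integrable M (\<lambda>\<omega>. ln (1 + exp (X \<omega>))) \<and>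
    (\<lambda>K. softplus_partial \<theta> \<tau> (2 * K)) \<longlonglongrightarrow> prob_space.expectation M (\<lambda>\<omega>. ln (1 + exp (X \<omega>)))"
proof -
  interpret prob_space M by fact
  note D = assms(3)
  have X [measurable]: "X \<in> borel_measurable M"
    using distributed_measurable[OF D] by simp
  define c where "c = \<tau> / sqrt (2 * pi) * exp (- \<theta>\<^sup>2 / (2 * \<tau>\<^sup>2)) + \<theta> * Phi (\<theta> / \<tau>)"
  define s where "s K \<omega> = (\<Sum>k = 1..2 * K. (- 1) ^ (k - 1) * (exp (- \<bar>X \<omega>\<bar>) ^ k / real k))" for K \<omega>
  let ?L = "\<lambda>\<omega>. ln (1 + exp (- \<bar>X \<omega>\<bar>))"
  have max: "has_bochner_integral M (\<lambda>\<omega>. max (X \<omega>) 0) c"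
    unfolding c_def using assms(2)
    by (intro has_bochner_integral_distributed[OF D] has_bochner_integral_normal_max_0) auto
  have "has_bochner_integral M (\<lambda>\<omega>. exp (- \<bar>X \<omega>\<bar>) ^ k / real k) (softplus_coeff \<theta> \<tau> k)"
    if "k \<in> {1..2 * K}" for k K
  proof -
    have "has_bochner_integral M (\<lambda>\<omega>. exp (- real k * \<bar>X \<omega>\<bar>)) (real k * softplus_coeff \<theta> \<tau> k)"
      using assms(2) that
      by (intro has_bochner_integral_distributed[OF D] has_bochner_integral_normal_exp_neg_abs) auto
    from has_bochner_integral_mult_right[OF this, of "1 / real k"] show ?thesis
      using that by (simp add: exp_of_nat_mult [symmetric])
  qed
  then have s: "has_bochner_integral M (s K)
      (\<Sum>k = 1..2 * K. (- 1) ^ (k - 1) * softplus_coeff \<theta> \<tau> k)" for K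
    unfolding s_def[abs_def]
    by (intro has_bochner_integral_sum has_bochner_integral_mult_right) blast
  \<comment> \<open>At \<open>X \<omega> = 0\<close> the series argument equals \<open>1\<close>,
    outside the range of \<open>ln_one_plus_alternating\<close>; this event is null because
    \<open>X\<close> has a density.\<close>
  have X_nz: "AE \<omega> in M. X \<omega> \<noteq> 0"
    using AE_lborel_singleton[of 0] by (subst distributed_AE2[OF D]) (auto elim!: eventually_mono)
  have L_meas: "?L \<in> borel_measurable M"
    by measurable
  have s_meas: "s K \<in> borel_measurable M" for K
    using borel_measurable_has_bochner_integral[OF s] .
  have lim: "AE \<omega> in M. (\<lambda>K. s K \<omega>) \<longlonglongrightarrow> ?L \<omega>"
    using X_nz unfolding s_def by eventually_elim (intro ln_one_plus_alternating(1), auto)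
  have bound: "AE \<omega> in M. norm (s K \<omega>) \<le> ln 2" for K
    using X_nz
  proof eventually_elim
    case (elim \<omega>)
    then show ?case
      using ln_one_plus_alternating(2,3)[of "exp (- \<bar>X \<omega>\<bar>)" K] by (simp add: s_def)
  qed
  \<comment> \<open>The dominating function is the constant \<open>ln 2\<close>, integrable because
    \<open>M\<close> is a probability space.\<close>
  have intL: "integrable M ?L"
    by (rule integrable_dominated_convergence[OF L_meas s_meas _ lim bound]) simp
  have limL: "(\<lambda>K. expectation (s K)) \<longlonglongrightarrow> expectation ?L"
    by (rule integral_dominated_convergence[OF L_meas s_meas _ lim bound]) simp
  have partial: "softplus_partial \<theta> \<tau> (2 * K) = c + expectation (s K)" for K
    using has_bochner_integral_integral_eq[OF s[of K]] by (simp add: softplus_partial_def c_def)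
  have "has_bochner_integral M (\<lambda>\<omega>. max (X \<omega>) 0 + ?L \<omega>) (c + expectation ?L)"
    using max intL by (intro has_bochner_integral_add has_bochner_integral_integrable)
  then have "has_bochner_integral M (\<lambda>\<omega>. ln (1 + exp (X \<omega>))) (c + expectation ?L)"
    unfolding ln_one_plus_exp_eq[of "X _", symmetric] .
  moreover have "(\<lambda>K. softplus_partial \<theta> \<tau> (2 * K)) \<longlonglongrightarrow> c + expectation ?L"
    unfolding partial by (intro tendsto_add tendsto_const limL)
  ultimately show ?thesis
    by (simp add: has_bochner_integral_iff)
qed

end
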